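(* Let $p,q\ge 1$ be integers, let $A_1,\dots,A_p>0$, $B_1,\dots,B_q>0$, $a_1,\dots,a_p\ge 0$, $b_1,\dots,b_q\ge 0$, and suppose that $$W(x)=\frac{\prod_{i=1}^{p}\Gamma(A_ix+a_i)}{\prod_{j=1}^{q}\Gamma(B_jx+b_j)},\qquad x>0,$$ is logarithmically completely monotonic on $(0,\infty)$. Then all of the following hold: (a) $\sum_{j=1}^{q}B_j=\sum_{i=1}^{p}A_i$; (b) $\rho:=\prod_{i=1}^{p}A_i^{A_i}\prod_{j=1}^{q}B_j^{-B_j}\le 1$; (c) $\mu:=\sum_{j=1}^{q}b_j-\sum_{i=1}^{p}a_i+\frac12(p-q)\ge 0$; (d) $\min_{1\le i\le p}(a_i/A_i)\le\min_{1\le j\le q}(b_j/B_j)$.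
   Context: A nonnegative function $f$ on $(0,\infty)$ is completely monotonic if it has derivatives of all orders and $(-1)^nf^{(n)}(x)\ge 0$ for all $n\ge 1$, $x>0$. A positive function $f$ on $(0,\infty)$ is logarithmically completely monotonic if $-(\log f)'$ is completely monotonic on $(0,\infty)$. $\Gamma$ is Euler's gamma function. *)

theory Defs
  imports "HOL-Analysis.Analysis"
begin

text \<open>
  The iterated derivatives below are only evaluated at points of the open half-line, where
  \<open>deriv\<close> depends only on the values of \<open>f\<close> near the point; the values of \<open>f\<close> on
  the nonpositive reals are therefore irrelevant. As \<open>deriv\<close> is a total function, existence
  of the derivatives is required explicitly.
\<close>

definition completely_monotonic :: "(real \<Rightarrow> real) \<Rightarrow> bool" where
  "completely_monotonic f \<longleftrightarrow>
     (\<forall>x>0. 0 \<le> f x) \<and>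
     (\<forall>n. \<forall>x>0. (deriv ^^ n) f field_differentiable at x) \<and>
     (\<forall>n\<ge>1. \<forall>x>0. 0 \<le> (-1) ^ n * (deriv ^^ n) f x)"

definition log_completely_monotonic :: "(real \<Rightarrow> real) \<Rightarrow> bool" where
  "log_completely_monotonic f \<longleftrightarrow>
     (\<forall>x>0. 0 < f x) \<and>
     (\<forall>x>0. (\<lambda>t. ln (f t)) field_differentiable at x) \<and>
     completely_monotonic (\<lambda>x. - deriv (\<lambda>t. ln (f t)) x)"

definition gamma_ratio ::
  "nat \<Rightarrow> nat \<Rightarrow> (nat \<Rightarrow> real) \<Rightarrow> (nat \<Rightarrow> real) \<Rightarrow> (nat \<Rightarrow> real) \<Rightarrow> (nat \<Rightarrow> real) \<Rightarrow> real \<Rightarrow> real" where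
  "gamma_ratio p q A a B b x =
     (\<Prod>i=1..p. Gamma (A i * x + a i)) / (\<Prod>j=1..q. Gamma (B j * x + b j))"

end

theory Submission
  imports Defs "HOL-Real_Asymp.Real_Asymp"
begin

text \<open>
  Write \<open>\<psi>\<close> for the digamma function and \<open>W\<close> for the Gamma ratio. The function
  \<open>f = - (ln W)'\<close> is
  \<open>f x = (\<Sum>j. B j * \<psi> (B j * x + b j)) - (\<Sum>i. A i * \<psi> (A i * x + a i))\<close>.
  The first three conclusions come from the behaviour of \<open>f\<close> at infinity and the last from
  its derivatives of high order.

  At infinity, \<open>\<psi> x = ln x - 1 / (2 * x) + O (1 / x ^ 2)\<close>
  (lemma \<open>Digamma_asymptotic_bounds\<close>) gives
  \<open>f x = s * ln x - ln \<rho> + \<mu> / x + o (1 / x)\<close>, where \<open>s\<close> is the sum of the \<open>B j\<close> minus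
  the sum of the \<open>A i\<close>. A nonnegative decreasing function can neither tend to infinity nor to
  minus infinity, hence \<open>s = 0\<close>; its limit \<open>- ln \<rho>\<close> is nonnegative; and, since it stays
  above its limit, \<open>\<mu> \<ge> 0\<close> (lemma \<open>nonneg_antimono_log_expansion\<close>).

  For the last conclusion, the poles of \<open>f\<close> lie at \<open>- (b j + k) / B j\<close> and
  \<open>- (a i + k) / A i\<close>, and for \<open>n \<ge> 1\<close>
  \<open>(-1) ^ n * (n-th derivative of f at x) / n!\<close> is the sum of \<open>d ^ (- n - 1)\<close> over the
  distances \<open>d\<close> from \<open>x\<close> to the poles of the second kind, minus the same sum over the poles
  of the first kind. As \<open>n\<close> grows, the pole nearest to \<open>x\<close> dominates, so nonnegativity for
  all \<open>n\<close> forces a pole of the second kind to be at least as near as every pole of the first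
  kind (lemma \<open>Min_shift_le_if_polygamma_sum_le\<close>). The nearest poles of the two kinds are at
  minus the two minima in the statement.
\<close>

section \<open>Second-order asymptotics of the digamma function\<close>

text \<open>
  An inequality for a function that vanishes at infinity follows from the sign of its increments
  over unit steps. For the digamma function these increments are elementary, by its
  recurrence.
\<close>

lemma limit_along_unit_steps_le:
  fixes u :: "real \<Rightarrow> real"
  assumes "0 < x" and step: "\<And>y. 0 < y \<Longrightarrow> u (y + 1) \<le> u y"
    and lim: "(\<lambda>n. u (x + real n)) \<longlonglongrightarrow> l"
  shows "l \<le> u x"
proof -
  have "decseq (\<lambda>n. u (x + real n))"
  proof (rule decseq_SucI)
    fix n show "u (x + real (Suc n)) \<le> u (x + real n)"
      using step[of "x + real n"] \<open>0 < x\<close> by (simp add: add_ac)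
  qed
  from decseq_ge[OF this lim, of 0] show ?thesis by simp
qed

text \<open>
  The quantity \<open>e\<close> is the error of the trapezoidal rule for the integral of \<open>1 / t\<close> over
  \<open>[x, x + 1]\<close>. It is nonnegative by convexity and of order \<open>x ^ (-3)\<close>. The upper bound is
  put in the form of a difference over a unit step so that it telescopes. Both inequalities
  hold because the difference of the two sides decreases to zero.
\<close>

lemma trapezoid_error_reciprocal:
  fixes x :: real
  assumes "0 < x"
  defines "e \<equiv> (1 / x + 1 / (x + 1)) / 2 - ln (x + 1) + ln x"
  shows "0 \<le> e" and "e \<le> 1 / x ^ 2 - 1 / (x + 1) ^ 2"
proof -
  let ?e = "\<lambda>t::real. (1 / t + 1 / (t + 1)) / 2 - ln (t + 1) + ln t"
  let ?d = "\<lambda>t::real. 1 / t ^ 2 - 1 / (t + 1) ^ 2 - ?e t"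
  have e': "(?e has_real_derivative - 1 / (2 * t ^ 2 * (t + 1) ^ 2)) (at t)" if "x \<le> t" for t
  proof -
    have t0: "0 < t" using assms(1) that by simp
    have "(?e has_real_derivative
        (- 1 / t ^ 2 + - 1 / (t + 1) ^ 2) / 2 - 1 / (t + 1) + 1 / t) (at t)"
      using t0 by (auto intro!: derivative_eq_intros simp: power2_eq_square)
    moreover have "(- 1 / t ^ 2 + - 1 / (t + 1) ^ 2) / 2 - 1 / (t + 1) + 1 / t
        = - 1 / (2 * t ^ 2 * (t + 1) ^ 2)"
      using t0 by (simp add: divide_simps) (simp add: algebra_simps power2_eq_square)
    ultimately show ?thesis by simp
  qed
  have lim: "(?e \<longlongrightarrow> 0) at_top" "(?d \<longlongrightarrow> 0) at_top" by real_asymp+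
  have "0 < ?e x"
  proof (rule DERIV_neg_imp_decreasing_at_top[OF _ lim(1)])
    fix t assume t: "x \<le> t"
    have "- 1 / (2 * t ^ 2 * (t + 1) ^ 2) < 0" using assms(1) t
      by (simp add: divide_neg_pos)
    with e'[OF t] show "\<exists>y. (?e has_real_derivative y) (at t) \<and> y < 0" by blast
  qed
  then show "0 \<le> e" unfolding e_def by simp
  have "0 < ?d x"
  proof (rule DERIV_neg_imp_decreasing_at_top[OF _ lim(2)])
    fix t assume t: "x \<le> t"
    then have t0: "0 < t" using assms(1) by simp
    have "(?d has_real_derivative
        (- 2 / t ^ 3 - - 2 / (t + 1) ^ 3) - (- 1 / (2 * t ^ 2 * (t + 1) ^ 2))) (at t)"
    proof (intro DERIV_diff e' t)
      show "((\<lambda>t. 1 / t ^ 2) has_real_derivative - 2 / t ^ 3) (at t)"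
        using t0 by (auto intro!: derivative_eq_intros simp: field_simps eval_nat_numeral)
      have "((\<lambda>t. 1 / (t + 1) ^ 2) has_real_derivative - (2 / (t + 1) ^ 3)) (at t)"
        using t0 by (auto intro!: derivative_eq_intros simp: divide_simps)
          (simp add: algebra_simps eval_nat_numeral)
      then show "((\<lambda>t. 1 / (t + 1) ^ 2) has_real_derivative - 2 / (t + 1) ^ 3) (at t)" by simp
    qed
    moreover have "(- 2 / t ^ 3 - - 2 / (t + 1) ^ 3) - (- 1 / (2 * t ^ 2 * (t + 1) ^ 2))
        = - (11 * t ^ 2 + 11 * t + 4) / (2 * t ^ 3 * (t + 1) ^ 3)"
      using t0 by (simp add: divide_simps) (simp add: algebra_simps power2_eq_square power3_eq_cube)
    moreover have "\<dots> < 0"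
    proof (rule divide_neg_pos)
      have "0 < 11 * t ^ 2 + 11 * t + 4" using t0 by (intro add_pos_pos) auto
      then show "- (11 * t ^ 2 + 11 * t + 4) < 0" by linarith
    qed (use t0 in simp)
    ultimately show "\<exists>y. (?d has_real_derivative y) (at t) \<and> y < 0"
      by (intro exI conjI) (assumption, simp only:)
  qed
  then show "e \<le> 1 / x ^ 2 - 1 / (x + 1) ^ 2" unfolding e_def by simp
qed

lemma Digamma_minus_ln_tendsto_0:
  fixes x :: real
  assumes "0 < x"
  shows "(\<lambda>n. Digamma (x + real n) - ln (x + real n)) \<longlonglongrightarrow> 0"
proof -
  have sum: "Digamma (x + real n) = Digamma x + (\<Sum>k<n. inverse (x + real k))" for n
  proof (induction n)
    case (Suc n)
    have "Digamma (x + real n + 1) = Digamma (x + real n) + 1 / (x + real n)"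
      using assms by (intro Digamma_plus1) auto
    with Suc show ?case by (simp add: add_ac inverse_eq_divide)
  qed simp
  have "(\<lambda>n. ln (real n) - (\<Sum>k<n. inverse (x + real k))) \<longlonglongrightarrow> Digamma x"
    using Digamma_LIMSEQ[of x] assms by simp
  moreover have "(\<lambda>n. ln (real n) - ln (x + real n)) \<longlonglongrightarrow> 0" by real_asymp
  ultimately have "(\<lambda>n. Digamma x - (ln (real n) - (\<Sum>k<n. inverse (x + real k)))
      + (ln (real n) - ln (x + real n))) \<longlonglongrightarrow> Digamma x - Digamma x + 0"
    by (intro tendsto_intros)
  then show ?thesis by (simp add: sum algebra_simps)
qed

text \<open>
  The remainder \<open>\<psi> x - ln x + 1 / (2 * x)\<close> increases by exactly the trapezoidal error
  when \<open>x\<close> grows by one, and it tends to zero along such steps. Summing the bounds on the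
  error from \<open>x\<close> to infinity gives both inequalities.
\<close>

lemma Digamma_asymptotic_bounds:
  fixes x :: real
  assumes "0 < x"
  shows "Digamma x - ln x + 1 / (2 * x) \<le> 0"
    and "- (1 / x ^ 2) \<le> Digamma x - ln x + 1 / (2 * x)"
proof -
  let ?r = "\<lambda>x::real. Digamma x - ln x + 1 / (2 * x)"
  have shift: "?r (y + 1) = ?r y + ((1 / y + 1 / (y + 1)) / 2 - ln (y + 1) + ln y)"
    if "0 < y" for y
  proof -
    have "1 / y + 1 / (2 * (y + 1)) = 1 / (2 * y) + (1 / y + 1 / (y + 1)) / 2"
      using that by (simp add: divide_simps)
    then show ?thesis using that by (simp add: Digamma_plus1)
  qed
  have "(\<lambda>n. 1 / (2 * (x + real n))) \<longlonglongrightarrow> 0" by real_asymp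
  from tendsto_add[OF Digamma_minus_ln_tendsto_0[OF assms] this]
  have lim: "(\<lambda>n. ?r (x + real n)) \<longlonglongrightarrow> 0" by simp
  have "0 \<le> - ?r x"
  proof (rule limit_along_unit_steps_le[OF assms])
    show "- ?r (y + 1) \<le> - ?r y" if "0 < y" for y
      using shift[OF that] trapezoid_error_reciprocal(1)[OF that] by simp
    show "(\<lambda>n. - ?r (x + real n)) \<longlonglongrightarrow> 0" using tendsto_minus[OF lim] by simp
  qed
  then show "?r x \<le> 0" by simp
  have "0 \<le> ?r x + 1 / x ^ 2"
  proof (rule limit_along_unit_steps_le[OF assms])
    show "?r (y + 1) + 1 / (y + 1) ^ 2 \<le> ?r y + 1 / y ^ 2" if "0 < y" for y
      using shift[OF that] trapezoid_error_reciprocal(2)[OF that] by linarith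
    have "(\<lambda>n. 1 / (x + real n) ^ 2) \<longlonglongrightarrow> 0" by real_asymp
    from tendsto_add[OF lim this]
    show "(\<lambda>n. ?r (x + real n) + 1 / (x + real n) ^ 2) \<longlonglongrightarrow> 0" by simp
  qed
  then show "- (1 / x ^ 2) \<le> ?r x" by simp
qed

text \<open>
  The terms \<open>C * ln x + C * ln C\<close> are the leading part of \<open>C * \<psi> (C * x + c)\<close>. The shift
  contributes \<open>c / x\<close> to the next order and the term \<open>- 1 / (2 * x)\<close> of the expansion of \<open>\<psi>\<close>
  the rest.
\<close>

lemma Digamma_affine_asymptotics:
  fixes C c :: real
  assumes C: "0 < C" and c: "0 \<le> c"
  shows "((\<lambda>x. x * (C * Digamma (C * x + c) - C * ln x - C * ln C)) \<longlongrightarrow> c - 1 / 2) at_top"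
proof -
  let ?r = "\<lambda>x::real. Digamma x - ln x + 1 / (2 * x)"
  have main: "((\<lambda>x. x * (C * ln (C * x + c) - C / (2 * (C * x + c)) - C * ln x - C * ln C))
      \<longlongrightarrow> c - 1 / 2) at_top"
    using C by (real_asymp simp: field_simps)
  have pos: "\<forall>\<^sub>F x in at_top. 0 < x \<and> 0 < C * x + c"
    using eventually_gt_at_top[of 0] by eventually_elim (use C c in \<open>auto simp: add_pos_nonneg\<close>)
  have rest: "((\<lambda>x. x * (C * ?r (C * x + c))) \<longlongrightarrow> 0) at_top"
  proof (rule tendsto_sandwich)
    show "\<forall>\<^sub>F x in at_top. - (x * C / (C * x + c) ^ 2) \<le> x * (C * ?r (C * x + c))"
      using pos
    proof eventually_elim
      case (elim x)
      then have "(x * C) * - (1 / (C * x + c) ^ 2) \<le> (x * C) * ?r (C * x + c)"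
        using Digamma_asymptotic_bounds(2)[of "C * x + c"] C by (intro mult_left_mono) auto
      then show ?case by (simp add: mult_ac)
    qed
    show "\<forall>\<^sub>F x in at_top. x * (C * ?r (C * x + c)) \<le> 0"
      using pos
    proof eventually_elim
      case (elim x)
      then show ?case
        using Digamma_asymptotic_bounds(1)[of "C * x + c"] C
        by (intro mult_nonneg_nonpos) auto
    qed
    show "((\<lambda>x. - (x * C / (C * x + c) ^ 2)) \<longlongrightarrow> 0) at_top" using C by real_asymp
  qed simp
  from tendsto_add[OF main rest]
  show ?thesis by (simp add: algebra_simps)
qed


section \<open>Consequences of monotonicity at infinity\<close>

text \<open>
  The logarithm would make \<open>f\<close> unbounded above, or eventually negative, unless its coefficient
  vanishes. Then \<open>l\<close> is the limit of \<open>f\<close>, hence nonnegative, and as \<open>f\<close> decreases it is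
  also a lower bound of \<open>f\<close>, which makes \<open>x * (f x - l)\<close> nonnegative.
\<close>

lemma nonneg_antimono_log_expansion:
  fixes f :: "real \<Rightarrow> real"
  assumes nonneg: "\<And>x. 0 < x \<Longrightarrow> 0 \<le> f x"
    and antimono: "\<And>x y. 0 < x \<Longrightarrow> x \<le> y \<Longrightarrow> f y \<le> f x"
    and expansion: "((\<lambda>x. x * (f x - s * ln x - l)) \<longlongrightarrow> m) at_top"
  shows "s = 0" and "0 \<le> l" and "0 \<le> m"
proof -
  have "((\<lambda>x. 1 / x * (x * (f x - s * ln x - l))) \<longlongrightarrow> 0 * m) at_top"
    by (intro tendsto_mult expansion) real_asymp
  then have "((\<lambda>x. f x - s * ln x - l) \<longlongrightarrow> 0 * m) at_top"
    by (rule Lim_transform_eventually)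
      (use eventually_gt_at_top[of "0::real"] in eventually_elim, simp)
  from tendsto_add[OF this tendsto_const[of l]]
  have lim: "((\<lambda>x. f x - s * ln x) \<longlongrightarrow> l) at_top" by simp
  have bounded: "\<forall>\<^sub>F x in at_top. 0 \<le> f x \<and> f x \<le> f 1"
    using eventually_ge_at_top[of 1] by eventually_elim (use nonneg antimono[of 1] in auto)
  show s: "s = 0"
  proof (rule ccontr)
    assume "s \<noteq> 0"
    then consider "0 < s" | "s < 0" by linarith
    then show False
    proof cases
      case 1
      then have "filterlim (\<lambda>x. s * ln x) at_top at_top"
        by (intro filterlim_tendsto_pos_mult_at_top[OF tendsto_const _ ln_at_top])
      from filterlim_tendsto_add_at_top[OF lim this]
      have "filterlim f at_top at_top" by simp
      then have "\<forall>\<^sub>F x in at_top. f 1 < f x" by (simp add: filterlim_at_top_dense)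
      with bounded have "\<forall>\<^sub>F x::real in at_top. False" by eventually_elim auto
      then show False by simp
    next
      case 2
      then have "filterlim (\<lambda>x. - s * ln x) at_top at_top"
        by (intro filterlim_tendsto_pos_mult_at_top[OF tendsto_const _ ln_at_top]) simp
      from filterlim_tendsto_add_at_top[OF tendsto_minus[OF lim] this]
      have "filterlim (\<lambda>x. - f x) at_top at_top" by simp
      then have "\<forall>\<^sub>F x in at_top. 0 < - f x" by (simp only: filterlim_at_top_dense)
      with bounded have "\<forall>\<^sub>F x::real in at_top. False" by eventually_elim auto
      then show False by simp
    qed
  qed
  with lim have lim_f: "(f \<longlongrightarrow> l) at_top" by simp
  show "0 \<le> l"
    by (rule tendsto_lowerbound[OF lim_f]) (use bounded in \<open>auto elim: eventually_mono\<close>)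
  have above: "l \<le> f x" if "0 < x" for x
  proof (rule tendsto_upperbound[OF lim_f])
    show "\<forall>\<^sub>F y in at_top. f y \<le> f x"
      using eventually_ge_at_top[of x] by eventually_elim (rule antimono[OF that])
  qed simp
  have "\<forall>\<^sub>F x in at_top. 0 \<le> x * (f x - s * ln x - l)"
    using eventually_gt_at_top[of "0::real"] by eventually_elim (use above s in auto)
  from tendsto_lowerbound[OF expansion this] show "0 \<le> m" by simp
qed

section \<open>Derivatives of the logarithm of a Gamma ratio\<close>

text \<open>
  The derivative of order \<open>n + 1\<close> of the logarithm of a product of factors
  \<open>\<Gamma> (C i * x + c i)\<close>; the power of \<open>C i\<close> comes from the chain rule.
\<close>

definition polygamma_sum :: "nat \<Rightarrow> (nat \<Rightarrow> real) \<Rightarrow> (nat \<Rightarrow> real) \<Rightarrow> nat \<Rightarrow> real \<Rightarrow> real" where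
  "polygamma_sum N C c n x = (\<Sum>i=1..N. C i ^ Suc n * Polygamma n (C i * x + c i))"

lemma has_field_derivative_polygamma_sum:
  assumes C: "\<And>i. i \<in> {1..N} \<Longrightarrow> 0 < C i" and c: "\<And>i. i \<in> {1..N} \<Longrightarrow> 0 \<le> c i"
    and x: "0 < x"
  shows "(polygamma_sum N C c n has_field_derivative polygamma_sum N C c (Suc n) x) (at x)"
  unfolding polygamma_sum_def [abs_def]
proof (rule DERIV_sum)
  fix i assume i: "i \<in> {1..N}"
  have "0 < C i * x + c i" using C[OF i] c[OF i] x by (simp add: add_pos_nonneg)
  then have "C i * x + c i \<notin> \<int>\<^sub>\<le>\<^sub>0" by (auto elim!: nonpos_Ints_cases)
  then show "((\<lambda>x. C i ^ Suc n * Polygamma n (C i * x + c i)) has_field_derivative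
      C i ^ Suc (Suc n) * Polygamma (Suc n) (C i * x + c i)) (at x)"
    by (auto intro!: derivative_eq_intros)
qed

lemma ln_prod_Gamma_has_field_derivative:
  assumes C: "\<And>i. i \<in> {1..N} \<Longrightarrow> 0 < C i" and c: "\<And>i. i \<in> {1..N} \<Longrightarrow> 0 \<le> c i"
    and x: "0 < x"
  shows "((\<lambda>t. \<Sum>i=1..N. ln_Gamma (C i * t + c i)) has_field_derivative
    polygamma_sum N C c 0 x) (at x)"
  unfolding polygamma_sum_def
proof (rule DERIV_sum)
  fix i assume i: "i \<in> {1..N}"
  have "0 < C i * x + c i" using C[OF i] c[OF i] x by (simp add: add_pos_nonneg)
  then show "((\<lambda>t. ln_Gamma (C i * t + c i)) has_field_derivative
      C i ^ Suc 0 * Digamma (C i * x + c i)) (at x)"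
    by (auto intro!: derivative_eq_intros)
qed

lemma ln_gamma_ratio:
  assumes A: "\<And>i. i \<in> {1..p} \<Longrightarrow> 0 < A i" and B: "\<And>j. j \<in> {1..q} \<Longrightarrow> 0 < B j"
    and a: "\<And>i. i \<in> {1..p} \<Longrightarrow> 0 \<le> a i" and b: "\<And>j. j \<in> {1..q} \<Longrightarrow> 0 \<le> b j"
    and x: "0 < x"
  shows "ln (gamma_ratio p q A a B b x) =
    (\<Sum>i=1..p. ln_Gamma (A i * x + a i)) - (\<Sum>j=1..q. ln_Gamma (B j * x + b j))"
proof -
  have pos: "0 < A i * x + a i" if "i \<in> {1..p}" for i
    using A[OF that] a[OF that] x by (simp add: add_pos_nonneg)
  have pos': "0 < B j * x + b j" if "j \<in> {1..q}" for j
    using B[OF that] b[OF that] x by (simp add: add_pos_nonneg)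
  have Gamma_nz: "Gamma y \<noteq> 0" if "0 < y" for y :: real
    using Gamma_real_pos[OF that] by simp
  have "0 < (\<Prod>i=1..p. Gamma (A i * x + a i))" "0 < (\<Prod>j=1..q. Gamma (B j * x + b j))"
    by (intro prod_pos Gamma_real_pos pos pos'; assumption)+
  then have "ln (gamma_ratio p q A a B b x) =
      ln (\<Prod>i=1..p. Gamma (A i * x + a i)) - ln (\<Prod>j=1..q. Gamma (B j * x + b j))"
    unfolding gamma_ratio_def by (rule ln_divide_pos)
  moreover have "ln (\<Prod>i=1..p. Gamma (A i * x + a i)) = (\<Sum>i=1..p. ln_Gamma (A i * x + a i))"
    using pos by (subst ln_prod) (auto intro!: sum.cong Gamma_nz simp: ln_Gamma_real_pos simp del: Gamma_eq_zero_iff)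
  moreover have "ln (\<Prod>j=1..q. Gamma (B j * x + b j)) = (\<Sum>j=1..q. ln_Gamma (B j * x + b j))"
    using pos' by (subst ln_prod) (auto intro!: sum.cong Gamma_nz simp: ln_Gamma_real_pos simp del: Gamma_eq_zero_iff)
  ultimately show ?thesis by simp
qed

lemma higher_deriv_neg_log_deriv_gamma_ratio:
  assumes A: "\<And>i. i \<in> {1..p} \<Longrightarrow> 0 < A i" and B: "\<And>j. j \<in> {1..q} \<Longrightarrow> 0 < B j"
    and a: "\<And>i. i \<in> {1..p} \<Longrightarrow> 0 \<le> a i" and b: "\<And>j. j \<in> {1..q} \<Longrightarrow> 0 \<le> b j"
    and x: "0 < x"
  shows "(deriv ^^ n) (\<lambda>x. - deriv (\<lambda>t. ln (gamma_ratio p q A a B b t)) x) x =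
    polygamma_sum q B b n x - polygamma_sum p A a n x"
  using x
proof (induction n arbitrary: x)
  case 0
  have "((\<lambda>t. (\<Sum>i=1..p. ln_Gamma (A i * t + a i)) - (\<Sum>j=1..q. ln_Gamma (B j * t + b j)))
      has_field_derivative polygamma_sum p A a 0 x - polygamma_sum q B b 0 x) (at x)"
    using A B a b 0 by (intro DERIV_diff ln_prod_Gamma_has_field_derivative)
  then have "((\<lambda>t. ln (gamma_ratio p q A a B b t))
      has_field_derivative polygamma_sum p A a 0 x - polygamma_sum q B b 0 x) (at x)"
  proof (rule has_field_derivative_transform_within_open[where S = "{0<..}"])
    fix t :: real assume "t \<in> {0<..}"
    then have "0 < t" by simp
    with A B a b show "(\<Sum>i=1..p. ln_Gamma (A i * t + a i)) - (\<Sum>j=1..q. ln_Gamma (B j * t + b j))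
        = ln (gamma_ratio p q A a B b t)" by (rule ln_gamma_ratio[symmetric])
  qed (use 0 in auto)
  then show ?case by (simp add: DERIV_imp_deriv)
next
  case (Suc n)
  have "((\<lambda>x. polygamma_sum q B b n x - polygamma_sum p A a n x)
      has_field_derivative polygamma_sum q B b (Suc n) x - polygamma_sum p A a (Suc n) x) (at x)"
    using A B a b Suc.prems by (intro DERIV_diff has_field_derivative_polygamma_sum)
  then have "((deriv ^^ n) (\<lambda>x. - deriv (\<lambda>t. ln (gamma_ratio p q A a B b t)) x)
      has_field_derivative polygamma_sum q B b (Suc n) x - polygamma_sum p A a (Suc n) x) (at x)"
    by (rule has_field_derivative_transform_within_open[where S = "{0<..}"])
      (use Suc in auto)
  then show ?case by (simp add: DERIV_imp_deriv)
qed

lemma polygamma_sum_0_asymptotics: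
  assumes C: "\<And>i. i \<in> {1..N} \<Longrightarrow> 0 < C i" and c: "\<And>i. i \<in> {1..N} \<Longrightarrow> 0 \<le> c i"
  shows "((\<lambda>x. x * (polygamma_sum N C c 0 x - (\<Sum>i=1..N. C i) * ln x - (\<Sum>i=1..N. C i * ln (C i))))
    \<longlongrightarrow> (\<Sum>i=1..N. c i) - real N / 2) at_top"
proof -
  have "((\<lambda>x. \<Sum>i=1..N. x * (C i * Digamma (C i * x + c i) - C i * ln x - C i * ln (C i)))
      \<longlongrightarrow> (\<Sum>i=1..N. c i - 1 / 2)) at_top"
    by (intro tendsto_sum Digamma_affine_asymptotics C c)
  then show ?thesis
    by (simp add: polygamma_sum_def sum_subtractf sum_distrib_left sum_distrib_right
        right_diff_distrib mult_ac)
qed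

section \<open>Comparison of the nearest poles\<close>

text \<open>
  The series of the polygamma function, scaled so that the bases
  \<open>C / (C * x + c + k)\<close> are the reciprocal distances from \<open>x\<close> to the poles
  \<open>- (c + k) / C\<close>.
\<close>

lemma Polygamma_affine_sums:
  fixes C c x :: real
  assumes "0 < C" "0 \<le> c" "0 < x" "0 < n"
  shows "(\<lambda>k. (C / (C * x + c + real k)) ^ Suc n) sums
    ((-1) ^ Suc n * (C ^ Suc n * Polygamma n (C * x + c)) / fact n)"
proof -
  have "0 < C * x + c" using assms by (simp add: add_pos_nonneg)
  then have "(\<lambda>k. inverse ((C * x + c + real k) ^ Suc n)) sums
      ((-1) ^ Suc n * Polygamma n (C * x + c) / fact n)"
    using Polygamma_LIMSEQ[of "C * x + c" n] assms by simp
  from sums_mult[OF this, of "C ^ Suc n"] show ?thesis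
    by (simp add: power_divide divide_inverse power_mult_distrib power_inverse mult_ac
        del: power_Suc)
qed

text \<open>
  All terms of the pole expansion are nonnegative, so a single one, the term \<open>k = 0\<close> of the
  factor \<open>j\<close>, bounds the sum from below.
\<close>

lemma polygamma_sum_ge_power:
  assumes C: "\<And>i. i \<in> {1..N} \<Longrightarrow> 0 < C i" and c: "\<And>i. i \<in> {1..N} \<Longrightarrow> 0 \<le> c i"
    and x: "0 < x" and n: "0 < n" and j: "j \<in> {1..N}"
  shows "(C j / (C j * x + c j)) ^ Suc n \<le> (-1) ^ Suc n * polygamma_sum N C c n x / fact n"
proof -
  let ?t = "\<lambda>i. (-1) ^ Suc n * (C i ^ Suc n * Polygamma n (C i * x + c i)) / fact n"
  have first: "(C i / (C i * x + c i)) ^ Suc n \<le> ?t i" "0 \<le> ?t i" if "i \<in> {1..N}" for i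
  proof -
    let ?u = "\<lambda>k. (C i / (C i * x + c i + real k)) ^ Suc n"
    have nonneg: "0 \<le> ?u k" for k
      using C[OF that] c[OF that] x by (intro zero_le_power divide_nonneg_nonneg) auto
    have "?u sums ?t i" using that by (intro Polygamma_affine_sums C c x n)
    with sum_le_suminf[of ?u "{0}"] nonneg have "?u 0 \<le> ?t i" by (auto simp: sums_iff)
    with nonneg[of 0] show "(C i / (C i * x + c i)) ^ Suc n \<le> ?t i" "0 \<le> ?t i" by simp_all
  qed
  have "(C j / (C j * x + c j)) ^ Suc n \<le> ?t j" by (rule first(1)[OF j])
  also have "\<dots> \<le> (\<Sum>i=1..N. ?t i)"
    using j first(2) by (intro member_le_sum) auto
  also have "\<dots> = (-1) ^ Suc n * polygamma_sum N C c n x / fact n"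
    by (simp only: polygamma_sum_def sum_distrib_left sum_divide_distrib)
  finally show ?thesis .
qed

text \<open>
  If every reciprocal distance is at most \<open>r\<close>, then \<open>m\<close> of the \<open>m + 2\<close> factors of each term
  can be replaced by \<open>r\<close>. The remaining squares still have a finite sum, which does not
  depend on \<open>m\<close>: it is the trigamma sum (order \<open>1\<close>).
\<close>

lemma polygamma_sum_le_geometric:
  assumes C: "\<And>i. i \<in> {1..N} \<Longrightarrow> 0 < C i" and c: "\<And>i. i \<in> {1..N} \<Longrightarrow> 0 \<le> c i"
    and x: "0 < x" and r: "\<And>i. i \<in> {1..N} \<Longrightarrow> C i / (C i * x + c i) \<le> r"
  shows "(-1) ^ Suc (Suc m) * polygamma_sum N C c (Suc m) x / fact (Suc m)
    \<le> r ^ m * polygamma_sum N C c 1 x"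
proof -
  have term_le: "(-1) ^ Suc (Suc m) * (C i ^ Suc (Suc m) * Polygamma (Suc m) (C i * x + c i)) / fact (Suc m)
      \<le> r ^ m * (C i ^ Suc 1 * Polygamma 1 (C i * x + c i))" if i: "i \<in> {1..N}" for i
  proof (rule sums_le)
    let ?v = "\<lambda>k. C i / (C i * x + c i + real k)"
    show "(\<lambda>k. ?v k ^ Suc (Suc m)) sums
        ((-1) ^ Suc (Suc m) * (C i ^ Suc (Suc m) * Polygamma (Suc m) (C i * x + c i)) / fact (Suc m))"
      using i by (intro Polygamma_affine_sums C c x) auto
    have "(\<lambda>k. ?v k ^ Suc 1) sums
        ((-1) ^ Suc 1 * (C i ^ Suc 1 * Polygamma 1 (C i * x + c i)) / fact 1)"
      using i by (intro Polygamma_affine_sums C c x) auto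
    then show "(\<lambda>k. r ^ m * ?v k ^ Suc 1) sums (r ^ m * (C i ^ Suc 1 * Polygamma 1 (C i * x + c i)))"
      by (intro sums_mult) simp
    fix k
    have pos: "0 < C i * x + c i" using C[OF i] c[OF i] x by (simp add: add_pos_nonneg)
    have "?v k \<le> C i / (C i * x + c i)"
      using C[OF i] pos by (intro divide_left_mono) auto
    with r[OF i] have "?v k \<le> r" by simp
    moreover have "0 \<le> ?v k" using C[OF i] pos by (intro divide_nonneg_nonneg) auto
    ultimately have "?v k ^ m * ?v k ^ Suc 1 \<le> r ^ m * ?v k ^ Suc 1"
      by (intro mult_right_mono power_mono) auto
    then show "?v k ^ Suc (Suc m) \<le> r ^ m * ?v k ^ Suc 1"
      by (simp add: mult_ac)
  qed
  show ?thesis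
    unfolding polygamma_sum_def sum_distrib_left sum_divide_distrib by (rule sum_mono) (rule term_le)
qed

lemma le_if_power_le_const_power:
  fixes r s K :: real
  assumes "0 < r" "0 < s" and le: "\<And>m. s ^ Suc (Suc m) \<le> r ^ m * K"
  shows "s \<le> r"
proof (rule ccontr)
  assume "\<not> s \<le> r"
  with assms(1) have "1 < s / r" by simp
  then obtain m where "K / s ^ 2 < (s / r) ^ m" using real_arch_pow by blast
  then have "r ^ m * K < s ^ Suc (Suc m)"
    using assms(1,2) by (simp add: power_divide field_simps power2_eq_square)
  with le[of m] show False by simp
qed

text \<open>
  The reciprocal distances from \<open>x\<close> to the nearest poles of the two kinds are
  \<open>1 / (x + \<beta>)\<close> and \<open>1 / (x + \<alpha>)\<close>, with \<open>\<alpha>\<close> and \<open>\<beta>\<close> the two minima. The lower bound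
  for the one sum and the upper bound for the other give
  \<open>(1 / (x + \<beta>)) ^ (m + 2) \<le> K * (1 / (x + \<alpha>)) ^ m\<close> with a constant \<open>K\<close> for all \<open>m\<close>,
  which orders the bases.
\<close>

lemma Min_shift_le_if_polygamma_sum_le:
  assumes A: "\<And>i. i \<in> {1..p} \<Longrightarrow> 0 < A i" and B: "\<And>j. j \<in> {1..q} \<Longrightarrow> 0 < B j"
    and a: "\<And>i. i \<in> {1..p} \<Longrightarrow> 0 \<le> a i" and b: "\<And>j. j \<in> {1..q} \<Longrightarrow> 0 \<le> b j"
    and pq: "1 \<le> p" "1 \<le> q" and x: "0 < x"
    and le: "\<And>n. 0 < n \<Longrightarrow>
      0 \<le> (-1) ^ n * (polygamma_sum q B b n x - polygamma_sum p A a n x)"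
  shows "(MIN i\<in>{1..p}. a i / A i) \<le> (MIN j\<in>{1..q}. b j / B j)"
proof -
  let ?\<alpha> = "MIN i\<in>{1..p}. a i / A i" and ?\<beta> = "MIN j\<in>{1..q}. b j / B j"
  have ratio: "C / (C * x + c) = 1 / (x + c / C)" if "0 < C" for C c :: real
    using that by (simp add: field_simps)
  have "?\<beta> \<in> (\<lambda>j. b j / B j) ` {1..q}" using pq by (intro Min_in) auto
  then obtain j where j: "j \<in> {1..q}" and \<beta>: "?\<beta> = b j / B j" by auto
  have "?\<alpha> \<in> (\<lambda>i. a i / A i) ` {1..p}" using pq by (intro Min_in) auto
  then have \<alpha>0: "0 \<le> ?\<alpha>" by (auto intro!: divide_nonneg_pos A a)
  have \<beta>0: "0 \<le> ?\<beta>" using \<beta> B[OF j] b[OF j] by simp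
  have "1 / (x + ?\<beta>) \<le> 1 / (x + ?\<alpha>)"
  proof (rule le_if_power_le_const_power)
    show "0 < 1 / (x + ?\<alpha>)" "0 < 1 / (x + ?\<beta>)" using x \<alpha>0 \<beta>0 by (simp_all add: add_pos_nonneg)
    fix m
    have r: "A i / (A i * x + a i) \<le> 1 / (x + ?\<alpha>)" if i: "i \<in> {1..p}" for i
    proof -
      have "?\<alpha> \<le> a i / A i" using i by (intro Min_le) auto
      then show ?thesis using ratio[OF A[OF i]] x \<alpha>0 by (simp add: frac_le)
    qed
    have "(1 / (x + ?\<beta>)) ^ Suc (Suc m)
        \<le> (-1) ^ Suc (Suc m) * polygamma_sum q B b (Suc m) x / fact (Suc m)"
    proof -
      have "(B j / (B j * x + b j)) ^ Suc (Suc m)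
          \<le> (-1) ^ Suc (Suc m) * polygamma_sum q B b (Suc m) x / fact (Suc m)"
        using B b x zero_less_Suc j by (rule polygamma_sum_ge_power)
      then show ?thesis by (simp only: ratio[OF B[OF j]] \<beta>)
    qed
    also have "\<dots> \<le> (-1) ^ Suc (Suc m) * polygamma_sum p A a (Suc m) x / fact (Suc m)"
      using le[of "Suc m"] by (intro divide_right_mono) (auto simp: right_diff_distrib)
    also have "\<dots> \<le> (1 / (x + ?\<alpha>)) ^ m * polygamma_sum p A a 1 x"
      using A a x r by (rule polygamma_sum_le_geometric)
    finally show "(1 / (x + ?\<beta>)) ^ Suc (Suc m) \<le> (1 / (x + ?\<alpha>)) ^ m * polygamma_sum p A a 1 x" .
  qed
  moreover have "0 < x + ?\<alpha>" "0 < x + ?\<beta>" using x \<alpha>0 \<beta>0 by simp_all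
  ultimately show ?thesis by (simp add: field_simps)
qed

section \<open>Necessary conditions on the parameters\<close>

theorem corollary1:
  fixes p q :: nat and A a B b :: "nat \<Rightarrow> real"
  assumes "1 \<le> p" and "1 \<le> q"
    and "\<And>i. i \<in> {1..p} \<Longrightarrow> 0 < A i" and "\<And>j. j \<in> {1..q} \<Longrightarrow> 0 < B j"
    and "\<And>i. i \<in> {1..p} \<Longrightarrow> 0 \<le> a i" and "\<And>j. j \<in> {1..q} \<Longrightarrow> 0 \<le> b j"
    and "log_completely_monotonic (gamma_ratio p q A a B b)"
  shows "(\<Sum>j=1..q. B j) = (\<Sum>i=1..p. A i) \<and>
    (\<Prod>i=1..p. A i powr A i) * (\<Prod>j=1..q. B j powr (- B j)) \<le> 1 \<and>
    0 \<le> (\<Sum>j=1..q. b j) - (\<Sum>i=1..p. a i) + 1 / 2 * (real p - real q) \<and>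
    (MIN i\<in>{1..p}. a i / A i) \<le> (MIN j\<in>{1..q}. b j / B j)"
proof -
  note A = assms(3) and B = assms(4) and a = assms(5) and b = assms(6)
  let ?f = "\<lambda>n x. polygamma_sum q B b n x - polygamma_sum p A a n x"
  let ?s = "(\<Sum>j=1..q. B j) - (\<Sum>i=1..p. A i)"
  let ?l = "(\<Sum>j=1..q. B j * ln (B j)) - (\<Sum>i=1..p. A i * ln (A i))"
  have higher_deriv: "(deriv ^^ n) (\<lambda>x. - deriv (\<lambda>t. ln (gamma_ratio p q A a B b t)) x) x = ?f n x"
    if "0 < x" for n x
    using A B a b that by (rule higher_deriv_neg_log_deriv_gamma_ratio)
  have cm: "completely_monotonic (\<lambda>x. - deriv (\<lambda>t. ln (gamma_ratio p q A a B b t)) x)"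
    using assms(7) by (simp add: log_completely_monotonic_def)
  have nonneg: "0 \<le> ?f 0 x" if "0 < x" for x
  proof -
    have "0 \<le> (deriv ^^ 0) (\<lambda>x. - deriv (\<lambda>t. ln (gamma_ratio p q A a B b t)) x) x"
      using cm that by (simp add: completely_monotonic_def)
    then show ?thesis by (simp only: higher_deriv[OF that])
  qed
  have signs: "0 \<le> (-1) ^ n * ?f n x" if "0 < n" "0 < x" for n x
  proof -
    have "0 \<le> (-1) ^ n * (deriv ^^ n) (\<lambda>x. - deriv (\<lambda>t. ln (gamma_ratio p q A a B b t)) x) x"
      using cm that by (simp add: completely_monotonic_def)
    then show ?thesis by (simp only: higher_deriv[OF that(2)])
  qed
  have antimono: "?f 0 y \<le> ?f 0 x" if "0 < x" "x \<le> y" for x y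
  proof (rule DERIV_nonpos_imp_nonincreasing[OF that(2)])
    fix t assume "x \<le> t"
    with that have t: "0 < t" by simp
    have "(?f 0 has_real_derivative ?f 1 t) (at t)"
      unfolding One_nat_def
      by (intro DERIV_diff has_field_derivative_polygamma_sum A a B b t)
    moreover have "?f 1 t \<le> 0" using signs[of 1 t] t by simp
    ultimately show "\<exists>z. (?f 0 has_real_derivative z) (at t) \<and> z \<le> 0" by blast
  qed
  let ?D = "\<lambda>N C c x. x * (polygamma_sum N C c 0 x - (\<Sum>i=1..N. C i) * ln x - (\<Sum>i=1..N. C i * ln (C i)))"
  let ?m = "((\<Sum>j=1..q. b j) - real q / 2) - ((\<Sum>i=1..p. a i) - real p / 2)"
  have "((\<lambda>x. ?D q B b x - ?D p A a x) \<longlongrightarrow> ?m) at_top"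
    by (intro tendsto_diff polygamma_sum_0_asymptotics A a B b)
  then have "((\<lambda>x. x * (?f 0 x - ?s * ln x - ?l)) \<longlongrightarrow> ?m) at_top"
    by (simp add: algebra_simps)
  note constants = nonneg_antimono_log_expansion[OF nonneg antimono this]
  \<comment> \<open>Used with \<open>t = 1\<close> for the numerator and \<open>t = - 1\<close> for the denominator of \<open>\<rho>\<close>.\<close>
  have powr_prod: "(\<Prod>i=1..N. C i powr (t * C i)) = exp (t * (\<Sum>i=1..N. C i * ln (C i)))"
    if "\<And>i. i \<in> {1..N} \<Longrightarrow> 0 < C i" for N t and C :: "nat \<Rightarrow> real"
  proof -
    have "(\<Prod>i=1..N. C i powr (t * C i)) = (\<Prod>i=1..N. exp (t * (C i * ln (C i))))"
      by (rule prod.cong) (use that in \<open>force simp: powr_def\<close>)+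
    then show ?thesis by (simp add: exp_sum sum_distrib_left)
  qed
  have "(\<Prod>i=1..p. A i powr A i) * (\<Prod>j=1..q. B j powr (- B j)) = exp (- ?l)"
    using powr_prod[of p A 1] powr_prod[of q B "- 1"] A B
    by (simp add: exp_add[symmetric])
  with constants(2) have "(\<Prod>i=1..p. A i powr A i) * (\<Prod>j=1..q. B j powr (- B j)) \<le> 1" by simp
  moreover have "(MIN i\<in>{1..p}. a i / A i) \<le> (MIN j\<in>{1..q}. b j / B j)"
    using A B a b assms(1,2) zero_less_one signs[OF _ zero_less_one]
    by (rule Min_shift_le_if_polygamma_sum_le)
  ultimately show ?thesis using constants(1,3) by (simp add: field_simps)
qed

end
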